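(* Let $\mathcal G(\pi,V)$ be a nonlocal game with question sets $S,T$ and answer sets $A,B$, let $N=|S||A|+|T||B|$, and let $\mathcal K\subseteq\mathcal N^N$ be a convex cone. The game $\mathcal G$ admits a perfect $\mathcal K$-strategy if and only if there exists $X\in\mathcal K$ such that $\langle J_{i,j},X\rangle=1$ for all $i,j\in S\cup T$, and $X[(s,a),(t,b)]=0$ for all $a,b,s,t$ with $\pi(s,t)>0$ and $V(a,b|s,t)=0$.
   Context: A nonlocal game $\mathcal G(\pi,V)$ consists of finite nonempty sets $S,T$ (questions), $A,B$ (answers), a probability distribution $\pi$ on $S\times T$ and a predicate $V:A\times B\times S\times T\to\{0,1\}$, written $V(a,b|s,t)$. $\mathcal N^N$ is the set of entrywise nonnegative real symmetric $N\times N$ matrices. Real symmetric $N\times N$ matrices are indexed by the disjoint union of $S\times A$ and $T\times B$ (in $S\cup T$, $S$ and $T$ are regarded as disjoint). For $i,j\in S\cup T$, $\langle J_{i,j},X\rangle:=\sum_{k,l}X[(i,k),(j,l)]$ is the sum of entries in block $(i,j)$ ($k\in A$ if $i\in S$, $k\in B$ if $i\in T$; likewise $l$ and $j$). $\mathrm{Corr}(\mathcal K)$ is the set of vectors $p=(p(a,b|s,t))$ for which there is $X\in\mathcal K$ with $\langle J_{i,j},X\rangle=1$ for all $i,j\in S\cup T$ and $X[(s,a),(t,b)]=p(a,b|s,t)$ for all $a,b,s,t$. The $\mathcal K$-value $\omega(\mathcal K,\mathcal G)$ is the supremum of $\sum_{s,t}\pi(s,t)\sum_{a,b}V(a,b|s,t)p(a,b|s,t)$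 over $p\in\mathrm{Corr}(\mathcal K)$. $\mathcal G$ admits a perfect $\mathcal K$-strategy if $\omega(\mathcal K,\mathcal G)=1$ and this value is achieved by some $p\in\mathrm{Corr}(\mathcal K)$. *)

theory Defs
  imports "HOL-Probability.Probability"
begin

text \<open>
  The finite nonempty sets \<open>S\<close>, \<open>T\<close>, \<open>A\<close>, \<open>B\<close> are the universes of types \<open>'s\<close>, \<open>'t\<close>, \<open>'a\<close>, \<open>'b\<close>
  of class \<^class>\<open>finite\<close>. Questions in the disjoint union of \<open>S\<close> and \<open>T\<close> have type \<open>'s + 't\<close>.
\<close>

type_synonym ('s, 't, 'a, 'b) index = "('s \<times> 'a) + ('t \<times> 'b)"

type_synonym ('s, 't, 'a, 'b) game_matrix =
  "real ^ ('s, 't, 'a, 'b) index ^ ('s, 't, 'a, 'b) index"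

type_synonym ('s, 't, 'a, 'b) correlation = "'a \<Rightarrow> 'b \<Rightarrow> 's \<Rightarrow> 't \<Rightarrow> real"

definition nonneg_symmetric :: "(real ^ 'n ^ 'n) set" where
  "nonneg_symmetric = {X. transpose X = X \<and> (\<forall>r c. 0 \<le> X $ r $ c)}"

fun block :: "'s + 't \<Rightarrow> ('s, 't, 'a, 'b) index set" where
  "block (Inl s) = {Inl (s, a) | a. True}"
| "block (Inr t) = {Inr (t, b) | b. True}"

text \<open>\<open>block_sum i j X\<close> is \<open>\<langle>J\<^sub>i\<^sub>j, X\<rangle>\<close>.\<close>

definition block_sum ::
  "'s + 't \<Rightarrow> 's + 't \<Rightarrow> ('s::finite, 't::finite, 'a::finite, 'b::finite) game_matrix \<Rightarrow> real" where
  "block_sum i j X = (\<Sum>r\<in>block i. \<Sum>c\<in>block j. X $ r $ c)"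

definition Corr ::
  "('s::finite, 't::finite, 'a::finite, 'b::finite) game_matrix set
    \<Rightarrow> ('s, 't, 'a, 'b) correlation set" where
  "Corr K = {p. \<exists>X\<in>K. (\<forall>i j. block_sum i j X = 1)
                    \<and> (\<forall>a b s t. X $ Inl (s, a) $ Inr (t, b) = p a b s t)}"

definition winning_prob ::
  "('s \<times> 't) pmf \<Rightarrow> ('a \<Rightarrow> 'b \<Rightarrow> 's \<Rightarrow> 't \<Rightarrow> bool)
    \<Rightarrow> ('s::finite, 't::finite, 'a::finite, 'b::finite) correlation \<Rightarrow> real" where
  "winning_prob \<pi> V p =
     (\<Sum>s\<in>UNIV. \<Sum>t\<in>UNIV. pmf \<pi> (s, t) *
        (\<Sum>a\<in>UNIV. \<Sum>b\<in>UNIV. of_bool (V a b s t) * p a b s t))"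

text \<open>
  The supremum is taken in \<^typ>\<open>ereal\<close>, so that it is meaningful for every \<open>K\<close>, also when
  \<^term>\<open>Corr K\<close> is empty (value \<open>-\<infinity>\<close>) or the set of winning probabilities is unbounded.
\<close>

definition game_value ::
  "('s::finite, 't::finite, 'a::finite, 'b::finite) game_matrix set
    \<Rightarrow> ('s \<times> 't) pmf \<Rightarrow> ('a \<Rightarrow> 'b \<Rightarrow> 's \<Rightarrow> 't \<Rightarrow> bool) \<Rightarrow> ereal" where
  "game_value K \<pi> V = (SUP p\<in>Corr K. ereal (winning_prob \<pi> V p))"

definition perfect_strategy ::
  "('s::finite, 't::finite, 'a::finite, 'b::finite) game_matrix set
    \<Rightarrow> ('s \<times> 't) pmf \<Rightarrow> ('a \<Rightarrow> 'b \<Rightarrow> 's \<Rightarrow> 't \<Rightarrow> bool) \<Rightarrow> bool" where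
  "perfect_strategy K \<pi> V \<longleftrightarrow>
     game_value K \<pi> V = 1 \<and> (\<exists>p\<in>Corr K. ereal (winning_prob \<pi> V p) = game_value K \<pi> V)"

end

theory Submission
  imports Defs
begin

text \<open>
  For a correlation, the probability of winning and the probability of winning the game with the
  complementary predicate add up to 1. The latter is a sum of nonnegative terms, so the value is at
  most 1, and a correlation attains 1 exactly when each of these terms vanishes.
\<close>

lemma block_sum_Inl_Inr:
  "block_sum (Inl s) (Inr t) X = (\<Sum>a\<in>UNIV. \<Sum>b\<in>UNIV. X $ Inl (s, a) $ Inr (t, b))"
proof -
  have 1: "block (Inl s) = (\<lambda>a. Inl (s, a)) ` UNIV" for s :: 's
    by auto
  have 2: "block (Inr t) = (\<lambda>b. Inr (t, b)) ` UNIV" for t :: 't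
    by auto
  show ?thesis
    unfolding block_sum_def 1 2 by (simp add: sum.reindex inj_on_def)
qed

text \<open>Every value of \<open>p\<close> is an entry of some matrix in \<open>K\<close>, so
  entrywise nonnegativity passes to \<open>p\<close>. This is where the hypothesis
  \<open>K \<subseteq> nonneg_symmetric\<close> enters the argument.\<close>

lemma Corr_nonneg:
  assumes "K \<subseteq> nonneg_symmetric" "p \<in> Corr K"
  shows "0 \<le> p a b s t"
  using assms unfolding Corr_def nonneg_symmetric_def by (auto simp: subset_iff) metis

text \<open>The values of \<open>p\<close> for a fixed question pair fill exactly the block
  \<open>(Inl s, Inr t)\<close> of the witnessing matrix, so the constraint on that block is
  normalization.\<close>

lemma Corr_sum_eq_1:
  assumes "p \<in> Corr K"
  shows "(\<Sum>a\<in>UNIV. \<Sum>b\<in>UNIV. p a b s t) = 1"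
proof -
  from assms obtain X where "block_sum (Inl s) (Inr t) X = 1"
      "\<forall>a b s t. X $ Inl (s, a) $ Inr (t, b) = p a b s t"
    unfolding Corr_def by blast
  then show ?thesis
    by (simp add: block_sum_Inl_Inr)
qed

text \<open>The indicators of \<open>V\<close> and of its negation add up to 1, so the two
  quantities together give the total mass of \<open>p\<close> averaged over
  \<open>\<pi>\<close>.\<close>

lemma winning_prob_complement:
  assumes "\<And>s t. (\<Sum>a\<in>UNIV. \<Sum>b\<in>UNIV. p a b s t) = 1"
  shows "winning_prob \<pi> V p = 1 - winning_prob \<pi> (\<lambda>a b s t. \<not> V a b s t) p"
proof -
  have "winning_prob \<pi> V p + winning_prob \<pi> (\<lambda>a b s t. \<not> V a b s t) p
      = (\<Sum>s\<in>UNIV. \<Sum>t\<in>UNIV. pmf \<pi> (s, t) * (\<Sum>a\<in>UNIV. \<Sum>b\<in>UNIV. p a b s t))"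
    unfolding winning_prob_def sum.distrib[symmetric] distrib_left[symmetric]
    by (simp add: of_bool_not_iff algebra_simps)
  also have "\<dots> = (\<Sum>x\<in>UNIV. pmf \<pi> x)"
    by (simp add: assms) (simp add: sum.cartesian_product)
  also have "\<dots> = 1"
    by (simp add: sum_pmf_eq_1)
  finally show ?thesis
    by simp
qed

lemma winning_prob_nonneg:
  assumes "\<And>a b s t. 0 \<le> p a b s t"
  shows "0 \<le> winning_prob \<pi> V p"
  unfolding winning_prob_def by (intro sum_nonneg mult_nonneg_nonneg) (auto simp: assms)

text \<open>A finite sum of nonnegative terms vanishes only termwise. Applied to the negated
  predicate, this says that losing answers never occur on questions that are asked.\<close>

lemma winning_prob_eq_0_iff:
  assumes "\<And>a b s t. 0 \<le> p a b s t"
  shows "winning_prob \<pi> V p = 0 \<longleftrightarrow>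
    (\<forall>a b s t. pmf \<pi> (s, t) > 0 \<and> V a b s t \<longrightarrow> p a b s t = 0)"
  unfolding winning_prob_def
  by (simp add: sum_nonneg_eq_0_iff sum_nonneg assms less_le) blast

theorem lemma4p6:
  fixes \<pi> :: "('s::finite \<times> 't::finite) pmf"
    and V :: "'a::finite \<Rightarrow> 'b::finite \<Rightarrow> 's \<Rightarrow> 't \<Rightarrow> bool"
    and K :: "('s, 't, 'a, 'b) game_matrix set"
  assumes "K \<subseteq> nonneg_symmetric"
    and "convex K"
    and "cone K"
  shows "perfect_strategy K \<pi> V \<longleftrightarrow>
    (\<exists>X\<in>K. (\<forall>i j. block_sum i j X = 1) \<and>
       (\<forall>a b s t. pmf \<pi> (s, t) > 0 \<and> \<not> V a b s t \<longrightarrow> X $ Inl (s, a) $ Inr (t, b) = 0))"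
    (is "_ \<longleftrightarrow> ?R")
proof -
  have nonneg: "0 \<le> p a b s t" if "p \<in> Corr K" for p a b s t
    using Corr_nonneg[OF assms(1) that] .
  have compl: "winning_prob \<pi> V p = 1 - winning_prob \<pi> (\<lambda>a b s t. \<not> V a b s t) p"
    if "p \<in> Corr K" for p
    by (rule winning_prob_complement) (rule Corr_sum_eq_1[OF that])
  have le_1: "winning_prob \<pi> V p \<le> 1" if "p \<in> Corr K" for p
    using compl[OF that] winning_prob_nonneg[of p \<pi> "\<lambda>a b s t. \<not> V a b s t"] nonneg[OF that]
    by simp
  have eq_1_iff: "winning_prob \<pi> V p = 1 \<longleftrightarrow>
      (\<forall>a b s t. pmf \<pi> (s, t) > 0 \<and> \<not> V a b s t \<longrightarrow> p a b s t = 0)" if "p \<in> Corr K" for p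
    using compl[OF that] winning_prob_eq_0_iff[of p \<pi> "\<lambda>a b s t. \<not> V a b s t"] nonneg[OF that]
    by simp
  \<comment> \<open>By \<open>le_1\<close> the supremum is at most 1, so one correlation reaching 1
    fixes the value and attains it. Both clauses of \<open>perfect_strategy\<close> thus reduce to
    attainment.\<close>
  have "perfect_strategy K \<pi> V \<longleftrightarrow> (\<exists>p\<in>Corr K. winning_prob \<pi> V p = 1)"
  proof
    assume "perfect_strategy K \<pi> V"
    then show "\<exists>p\<in>Corr K. winning_prob \<pi> V p = 1"
      by (auto simp: perfect_strategy_def)
  next
    assume "\<exists>p\<in>Corr K. winning_prob \<pi> V p = 1"
    then obtain p where p: "p \<in> Corr K" "winning_prob \<pi> V p = 1"
      by blast
    have "game_value K \<pi> V = 1"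
      unfolding game_value_def
    proof (rule antisym)
      show "(SUP p\<in>Corr K. ereal (winning_prob \<pi> V p)) \<le> 1"
        by (rule SUP_least) (simp add: le_1)
      show "1 \<le> (SUP p\<in>Corr K. ereal (winning_prob \<pi> V p))"
        by (rule SUP_upper2[OF p(1)]) (simp add: p(2))
    qed
    with p show "perfect_strategy K \<pi> V"
      by (auto simp: perfect_strategy_def)
  qed
  also have "\<dots> \<longleftrightarrow> (\<exists>p\<in>Corr K.
      \<forall>a b s t. pmf \<pi> (s, t) > 0 \<and> \<not> V a b s t \<longrightarrow> p a b s t = 0)"
    by (simp add: eq_1_iff)
  \<comment> \<open>A correlation is only a view of the blocks of \<open>X\<close> that pair an
    \<open>'s\<close> question with a \<open>'t\<close> question, so quantifying over
    \<open>p\<close> amounts to quantifying over feasible \<open>X\<close>.\<close>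
  also have "\<dots> \<longleftrightarrow> ?R"
  proof
    assume "\<exists>p\<in>Corr K. \<forall>a b s t. pmf \<pi> (s, t) > 0 \<and> \<not> V a b s t \<longrightarrow> p a b s t = 0"
    then obtain p X where p: "\<forall>a b s t. pmf \<pi> (s, t) > 0 \<and> \<not> V a b s t \<longrightarrow> p a b s t = 0"
      and "X \<in> K" "\<forall>i j. block_sum i j X = 1"
      and X: "\<And>a b s t. X $ Inl (s, a) $ Inr (t, b) = p a b s t"
      unfolding Corr_def by blast
    moreover from p have
      "\<forall>a b s t. pmf \<pi> (s, t) > 0 \<and> \<not> V a b s t \<longrightarrow> X $ Inl (s, a) $ Inr (t, b) = 0"
      unfolding X .
    ultimately show ?R
      by blast
  next
    assume ?R
    then obtain X where X: "X \<in> K" "\<forall>i j. block_sum i j X = 1"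
      "\<forall>a b s t. pmf \<pi> (s, t) > 0 \<and> \<not> V a b s t \<longrightarrow> X $ Inl (s, a) $ Inr (t, b) = 0"
      by blast
    \<comment> \<open>The witness is read off from the entries of \<open>X\<close> in these
      blocks.\<close>
    from X(1,2) have "(\<lambda>a b s t. X $ Inl (s, a) $ Inr (t, b)) \<in> Corr K"
      unfolding Corr_def by auto
    with X(3) show "\<exists>p\<in>Corr K. \<forall>a b s t. pmf \<pi> (s, t) > 0 \<and> \<not> V a b s t \<longrightarrow> p a b s t = 0"
      by (intro bexI[where x = "\<lambda>a b s t. X $ Inl (s, a) $ Inr (t, b)"])
  qed
  finally show ?thesis .
qed

end
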